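(* For every integer $n\ge 0$ there is an explicit bijection between the set of $2$-colored Dyck bridges of length $2n$ and the set of unconstrained Dyck walks of length $2n$.
   Context: Steps are $\mathtt{u}=(1,1)$ and $\mathtt{d}=(1,-1)$. An unconstrained Dyck walk of length $m$ is a lattice path starting at $(0,0)$ with $m$ such steps, with no further restriction (it may go below the $x$-axis and end at any altitude). A Dyck bridge is a Dyck walk that ends on the $x$-axis. A $2$-colored Dyck bridge of length $2n$ is the concatenation of two (possibly empty) Dyck bridges of total length $2n$, the first one colored in color $1$ and the second one in color $2$; equivalently, an ordered pair of possibly empty Dyck bridges whose lengths sum to $2n$. *)

theory Defs
  imports Main "HOL-Library.Product_Plus"
begin

datatype step = U | D

fun step_vector :: "step \<Rightarrow> int \<times> int" where
  "step_vector U = (1, 1)"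
| "step_vector D = (1, -1)"

text \<open>A lattice path starting at the origin is represented by its sequence of steps.\<close>

type_synonym walk = "step list"

definition end_point :: "walk \<Rightarrow> int \<times> int" where
  "end_point w = sum_list (map step_vector w)"

definition dyck_walks :: "nat \<Rightarrow> walk set" where
  "dyck_walks m = {w. length w = m}"

definition dyck_bridge :: "walk \<Rightarrow> bool" where
  "dyck_bridge w \<longleftrightarrow> snd (end_point w) = 0"

text \<open>The first component is the part of color 1, the second the part of color 2. The cut point
  is part of the data: a bridge with several returns to the axis arises from several pairs.\<close>

definition two_colored_dyck_bridges :: "nat \<Rightarrow> (walk \<times> walk) set" where
  "two_colored_dyck_bridges m =
     {(b1, b2). dyck_bridge b1 \<and> dyck_bridge b2 \<and> length b1 + length b2 = m}"

fun flip :: "step \<Rightarrow> step" where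
  "flip U = D"
| "flip D = U"

text \<open>In \<open>lift h w\<close>, the number \<open>h\<close> is the current height above the minimum reached so far in the
  original path. Thus \<open>lift 0 w\<close> turns every down-step of \<open>w\<close> that reaches a new strict minimum
  into an up-step. The result stays weakly above its starting altitude.\<close>

fun lift :: "nat \<Rightarrow> walk \<Rightarrow> walk" where
  "lift h [] = []"
| "lift h (U # w) = U # lift (Suc h) w"
| "lift 0 (D # w) = U # lift 0 w"
| "lift (Suc h) (D # w) = D # lift h w"

text \<open>Keeps the first step of a bridge and lifts the remainder away from the axis, on the side
  chosen by that first step; the resulting walk never returns to the axis. A remainder that ends
  at \<open>-1\<close> and has minimum \<open>-m\<close> (relative to its start) is lifted to a path ending at \<open>2 m - 1\<close>.
  Hence the number of flipped steps, and with it the bridge, can be recovered.\<close>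

fun open_bridge :: "walk \<Rightarrow> walk" where
  "open_bridge [] = []"
| "open_bridge (U # r) = U # lift 0 r"
| "open_bridge (D # r) = D # map flip (lift 0 (map flip r))"

text \<open>The explicit bijection: the part of color 1 becomes the portion of the walk up to its last
  visit to the axis, the opened part of color 2 the portion after it.\<close>

definition walk_of_bridges :: "walk \<times> walk \<Rightarrow> walk" where
  "walk_of_bridges = (\<lambda>(b1, b2). b1 @ open_bridge b2)"

end

theory Submission
  imports Defs "HOL-Library.Sublist"
begin

text \<open>Every walk splits uniquely at its last visit to the axis into a bridge and a walk that never
  returns to the axis, so it suffices that opening is a bijection from bridges to non-returning
  walks of even length. By symmetry this reduces to the lifting of the walk after an initial
  up-step. If a walk \<open>w\<close> is at height \<open>e\<close> above its minimum and \<open>k\<close> steps have been flipped, then \<open>w\<close>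
  ends at \<open>e - k\<close> and its lift at \<open>e + k\<close>. Hence the lift together with the end of \<open>w\<close>
  determines \<open>k\<close>, and reading backwards, an up-step of the lift was flipped exactly when
  it ends at altitude \<open>k\<close>.\<close>

section \<open>Altitudes of walks, and the lifting together with its inverse\<close>

definition altitude :: "walk \<Rightarrow> int" where
  "altitude w = snd (end_point w)"

lemma altitude_Nil [simp]: "altitude [] = 0"
  by (simp add: altitude_def end_point_def)

lemma altitude_Cons [simp]: "altitude (s # w) = (if s = U then 1 else - 1) + altitude w"
  by (cases s) (simp_all add: altitude_def end_point_def)

lemma altitude_append [simp]: "altitude (v @ w) = altitude v + altitude w"
  by (induction v) auto

lemma dyck_bridge_iff: "dyck_bridge w \<longleftrightarrow> altitude w = 0"
  by (simp add: dyck_bridge_def altitude_def)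

lemma flip_eq_iff [simp]: "flip s = U \<longleftrightarrow> s = D"
  by (cases s) auto

lemma step_neq_iff [simp]:
  "s \<noteq> U \<longleftrightarrow> s = D"
  "s \<noteq> D \<longleftrightarrow> s = U"
  by (cases s; simp)+

lemma flip_flip [simp]: "flip (flip s) = s"
  by (cases s) auto

lemma flip_comp_flip [simp]: "flip \<circ> flip = id"
  by (simp add: fun_eq_iff)

lemma altitude_map_flip [simp]: "altitude (map flip w) = - altitude w"
  by (induction w) auto

lemma even_altitude_iff: "even (altitude w) \<longleftrightarrow> even (length w)"
  by (induction w) auto

text \<open>The final value of the counter that \<open>lift h\<close> carries along
  \<open>w\<close>; for \<open>h = 0\<close>, the height of the end of \<open>w\<close> above its
  minimum.\<close>

fun excess :: "nat \<Rightarrow> walk \<Rightarrow> nat" where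
  "excess h [] = h"
| "excess h (U # w) = excess (Suc h) w"
| "excess 0 (D # w) = excess 0 w"
| "excess (Suc h) (D # w) = excess h w"

lemma length_lift [simp]: "length (lift h w) = length w"
  by (induction h w rule: lift.induct) auto

lemma lift_append: "lift h (v @ w) = lift h v @ lift (excess h v) w"
  by (induction h v rule: lift.induct) auto

lemma excess_append: "excess h (v @ w) = excess (excess h v) w"
  by (induction h v rule: excess.induct) auto

text \<open>With k flipped steps, the lift ends 2k above \<open>w\<close>, and the excess is
  \<open>h + altitude w + k\<close>. Eliminating k gives the identity.\<close>

lemma altitude_lift: "altitude (lift h w) + altitude w + 2 * int h = 2 * int (excess h w)"
  by (induction h w rule: lift.induct) auto

text \<open>The counter never exceeds the current altitude of the lift shifted by \<open>h\<close>:
  the two move together except at a flipped step, where only the altitude rises.\<close>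

lemma altitude_lift_nonneg: "0 \<le> int h + altitude (lift h w)"
  by (induction h w rule: lift.induct) auto

lemma prefix_lift_altitude_nonneg:
  assumes "prefix p (lift 0 w)"
  shows "0 \<le> altitude p"
  using assms
proof (induction w arbitrary: p rule: rev_induct)
  case (snoc s w)
  obtain t where "lift 0 (w @ [s]) = lift 0 w @ [t]"
    using lift_append[of 0 w "[s]"] length_lift[of "excess 0 w" "[s]"]
    by (metis length_Suc_conv length_0_conv list.size(3))
  with snoc show ?case
    by (metis add_0 altitude_lift_nonneg of_nat_0 prefix_snoc)
qed simp

lemma lift_inject:
  assumes "lift 0 v = lift 0 w" "altitude v = altitude w"
  shows "v = w"
  using assms
proof (induction v arbitrary: w rule: rev_induct)
  case Nil
  then show ?case
    by (metis length_0_conv length_lift)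
next
  case (snoc s v)
  obtain w' t where w: "w = w' @ [t]"
    using snoc.prems(1) by (metis length_lift length_0_conv rev_exhaust snoc_eq_iff_butlast)
  have excess: "excess 0 (v @ [s]) = excess 0 w"
    using snoc.prems altitude_lift[of 0 "v @ [s]"] altitude_lift[of 0 w] by simp
  have eq: "lift 0 v = lift 0 w'" "lift (excess 0 v) [s] = lift (excess 0 w') [t]"
    using snoc.prems(1) unfolding w lift_append by (auto simp: append_eq_append_conv)
  \<comment> \<open>The last step of the lift and the final excess determine the last original step:
    an up-step of the lift was flipped exactly when the final excess is 0.\<close>
  have "s = t"
    using eq(2) excess unfolding w excess_append
    by (cases s; cases t; cases "excess 0 v"; cases "excess 0 w'") auto
  then show ?case
    using snoc.IH[OF eq(1)] snoc.prems(2) w by simp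
qed

text \<open>Here \<open>k\<close> is the prescribed number of flips. The preimage is built by
  reading \<open>v\<close> backwards.\<close>

lemma lift_surject:
  assumes "\<And>p. prefix p v \<Longrightarrow> 0 \<le> altitude p" "0 \<le> k" "k \<le> altitude v"
  shows "\<exists>w. lift 0 w = v \<and> altitude w = altitude v - 2 * k"
  using assms
proof (induction v arbitrary: k rule: rev_induct)
  case Nil
  then show ?case by (intro exI[of _ "[]"]) simp
next
  case (snoc s v)
  have nonneg: "\<And>p. prefix p v \<Longrightarrow> 0 \<le> altitude p"
    using snoc.prems(1) by simp
  then have nonneg_v: "0 \<le> altitude v" by simp
  \<comment> \<open>A final up-step arriving at altitude exactly \<open>k\<close> must have been
    flipped, which leaves \<open>k - 1\<close> flips for the rest.\<close>
  consider (down) "s = D" | (flipped) "s = U" "altitude v = k - 1" | (up) "s = U" "k \<le> altitude v"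
    using snoc.prems(3) by (cases s) (auto, linarith)
  then show ?case
  proof cases
    case down
    then obtain w where w: "lift 0 w = v" "altitude w = altitude v - 2 * k"
      using snoc.IH[OF nonneg, of k] snoc.prems by auto
    \<comment> \<open>The excess is \<open>altitude v - k\<close>; as it is positive, an appended
      down-step is kept.\<close>
    then have "0 < excess 0 w"
      using altitude_lift[of 0 w] snoc.prems(3) down by simp
    then show ?thesis
      using w down by (intro exI[of _ "w @ [D]"]) (auto simp: lift_append gr0_conv_Suc)
  next
    case flipped
    then obtain w where w: "lift 0 w = v" "altitude w = altitude v - 2 * (k - 1)"
      using snoc.IH[OF nonneg, of "k - 1"] nonneg_v by auto
    then have "excess 0 w = 0"
      using altitude_lift[of 0 w] flipped by simp
    then show ?thesis
      using w flipped by (intro exI[of _ "w @ [D]"]) (auto simp: lift_append)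
  next
    case up
    then obtain w where w: "lift 0 w = v" "altitude w = altitude v - 2 * k"
      using snoc.IH[OF nonneg, of k] snoc.prems by auto
    then show ?thesis
      using up by (intro exI[of _ "w @ [U]"]) (auto simp: lift_append)
  qed
qed

section \<open>Walks that never return to the axis\<close>

definition nonreturning :: "walk \<Rightarrow> bool" where
  "nonreturning w \<longleftrightarrow> (\<forall>p. prefix p w \<longrightarrow> p \<noteq> [] \<longrightarrow> altitude p \<noteq> 0)"

lemma nonreturning_snoc:
  "nonreturning (w @ [s]) \<longleftrightarrow> nonreturning w \<and> altitude (w @ [s]) \<noteq> 0"
  by (auto simp: nonreturning_def)

lemma nonreturning_map_flip:
  assumes "nonreturning w"
  shows "nonreturning (map flip w)"
  using assms by (induction w rule: rev_induct) (auto simp: nonreturning_snoc nonreturning_def)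

text \<open>Steps change the altitude by 1, so a walk that has risen to 1 cannot become negative
  without visiting 0.\<close>

lemma nonreturning_imp_altitude_nonneg:
  assumes "nonreturning (U # w)"
  shows "0 \<le> altitude w"
  using assms
proof (induction w rule: rev_induct)
  case (snoc s w)
  then show ?case
    using nonreturning_snoc[of "U # w" s] by (cases s) auto
qed simp

lemma nonreturning_UConsD:
  assumes "nonreturning (U # w)" "prefix p w"
  shows "0 \<le> altitude p"
proof (rule nonreturning_imp_altitude_nonneg)
  have "prefix q (U # w)" if "prefix q (U # p)" for q
    using that assms(2) by (meson Cons_prefix_Cons prefix_order.order_trans)
  then show "nonreturning (U # p)"
    using assms(1) by (auto simp: nonreturning_def)
qed

section \<open>Opening as a bijection from bridges to non-returning walks of even length\<close>

lemma open_bridge_map_flip: "open_bridge (map flip b) = map flip (open_bridge b)"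
  by (induction b rule: open_bridge.induct) auto

lemma length_open_bridge [simp]: "length (open_bridge b) = length b"
  by (induction b rule: open_bridge.induct) auto

lemma nonreturning_UCons_lift: "nonreturning (U # lift 0 r)"
  unfolding nonreturning_def
proof (intro allI impI)
  fix p assume "prefix p (U # lift 0 r)" "p \<noteq> []"
  then obtain q where "p = U # q" "prefix q (lift 0 r)"
    by (auto simp: prefix_Cons)
  then show "altitude p \<noteq> 0"
    using prefix_lift_altitude_nonneg[of q r] by simp
qed

lemma nonreturning_open_bridge: "nonreturning (open_bridge b)"
proof (cases b rule: open_bridge.cases)
  case 1
  then show ?thesis by (simp add: nonreturning_def)
next
  case (2 r)
  then show ?thesis by (simp add: nonreturning_UCons_lift)
next
  case (3 r)
  then show ?thesis
    using nonreturning_map_flip[OF nonreturning_UCons_lift[of "map flip r"]] by simp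
qed

text \<open>The first step is kept and fixes the side. The bridge condition then fixes the final
  altitude of the remainder, as \<open>lift_inject\<close> requires.\<close>

lemma open_bridge_inject:
  assumes "open_bridge b = open_bridge c" "altitude b = 0" "altitude c = 0"
  shows "b = c"
proof (cases b rule: open_bridge.cases)
  case 1
  then show ?thesis using assms(1) by (metis length_0_conv length_open_bridge)
next
  case (2 r)
  then show ?thesis
    using assms lift_inject[of r] by (cases c rule: open_bridge.cases) auto
next
  case (3 r)
  have inj: "inj (map flip)"
    by (metis flip_flip inj_mapI injI)
  obtain r' where "c = D # r'" "lift 0 (map flip r) = lift 0 (map flip r')"
    using assms(1) 3 by (cases c rule: open_bridge.cases) (auto dest: injD[OF inj])
  then show ?thesis
    using assms 3 lift_inject[of "map flip r" "map flip r'"] by (auto dest: injD[OF inj])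
qed

lemma open_bridge_surject_UCons:
  assumes "nonreturning (U # v)" "even (length (U # v))"
  shows "\<exists>b. altitude b = 0 \<and> open_bridge b = U # v"
proof -
  have "odd (altitude v)"
    using assms(2) by (simp add: even_altitude_iff)
  then obtain j where j: "altitude v = 2 * j + 1"
    by (elim oddE)
  have "0 \<le> altitude v"
    using nonreturning_UConsD[OF assms(1)] by simp
  \<comment> \<open>The number of flips \<open>j + 1\<close> is forced: \<open>r\<close> must end at
    -1 for \<open>U # r\<close> to be a bridge.\<close>
  then obtain r where "lift 0 r = v" "altitude r = altitude v - 2 * (j + 1)"
    using lift_surject[of v "j + 1"] nonreturning_UConsD[OF assms(1)] j by auto
  then show ?thesis
    using j by (intro exI[of _ "U # r"]) simp
qed

lemma open_bridge_surject:
  assumes "nonreturning w" "even (length w)"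
  shows "\<exists>b. altitude b = 0 \<and> open_bridge b = w"
proof (cases w rule: open_bridge.cases)
  case 1
  then show ?thesis by (intro exI[of _ "[]"]) simp
next
  case (2 v)
  then show ?thesis using assms open_bridge_surject_UCons by simp
next
  case (3 v)
  then obtain b where "altitude b = 0" "open_bridge b = map flip w"
    using open_bridge_surject_UCons[of "map flip v"] nonreturning_map_flip[OF assms(1)] assms(2)
    by auto
  then show ?thesis
    by (intro exI[of _ "map flip b"]) (simp add: open_bridge_map_flip)
qed

section \<open>Cutting a walk at its last visit to the axis\<close>

lemma last_visit_decomposition: "\<exists>x y. w = x @ y \<and> altitude x = 0 \<and> nonreturning y"
proof (induction w rule: rev_induct)
  case Nil
  then show ?case by (simp add: nonreturning_def)
next
  case (snoc s w)
  then obtain x y where xy: "w = x @ y" "altitude x = 0" "nonreturning y"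
    by blast
  show ?case
  proof (cases "altitude (w @ [s]) = 0")
    case True
    then show ?thesis
      by (intro exI[of _ "w @ [s]"] exI[of _ "[]"]) (simp add: nonreturning_def)
  next
    case False
    with xy show ?thesis
      by (intro exI[of _ x] exI[of _ "y @ [s]"]) (simp add: nonreturning_snoc)
  qed
qed

lemma last_visit_decomposition_unique:
  assumes "x @ y = x' @ y'" "altitude x = 0" "altitude x' = 0" "nonreturning y" "nonreturning y'"
  shows "x = x' \<and> y = y'"
proof -
  obtain u where "x = x' @ u \<and> u @ y = y' \<or> x @ u = x' \<and> y = u @ y'"
    using assms(1) by (auto simp: append_eq_append_conv2)
  \<comment> \<open>The piece \<open>u\<close> between the two cuts has altitude 0 and is a prefix
    of a non-returning tail.\<close>
  moreover from this have "u = []"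
    using assms unfolding nonreturning_def by (metis add_0 add_cancel_left_right altitude_append prefixI)
  ultimately show ?thesis
    by auto
qed

theorem proposition2p15:
  fixes n :: nat
  shows "bij_betw walk_of_bridges (two_colored_dyck_bridges (2 * n)) (dyck_walks (2 * n))"
proof (rule bij_betw_imageI)
  show "inj_on walk_of_bridges (two_colored_dyck_bridges (2 * n))"
  proof (rule inj_onI, clarify)
    fix b c b' c'
    assume "(b, c) \<in> two_colored_dyck_bridges (2 * n)" "(b', c') \<in> two_colored_dyck_bridges (2 * n)"
      and "walk_of_bridges (b, c) = walk_of_bridges (b', c')"
    then show "b = b' \<and> c = c'"
      using last_visit_decomposition_unique[of b "open_bridge c" b' "open_bridge c'"]
      by (auto simp: two_colored_dyck_bridges_def walk_of_bridges_def dyck_bridge_iff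
          nonreturning_open_bridge intro: open_bridge_inject)
  qed
  show "walk_of_bridges ` two_colored_dyck_bridges (2 * n) = dyck_walks (2 * n)"
  proof (intro equalityI subsetI)
    fix w assume "w \<in> walk_of_bridges ` two_colored_dyck_bridges (2 * n)"
    then show "w \<in> dyck_walks (2 * n)"
      by (auto simp: two_colored_dyck_bridges_def walk_of_bridges_def dyck_walks_def)
  next
    fix w assume "w \<in> dyck_walks (2 * n)"
    then have len: "length w = 2 * n"
      by (simp add: dyck_walks_def)
    obtain b y where split: "w = b @ y" "altitude b = 0" "nonreturning y"
      using last_visit_decomposition by blast
    \<comment> \<open>A bridge has even length, so the tail inherits the parity of the whole
      walk.\<close>
    then have "even (length y)"
      using even_altitude_iff[of b] len by (metis dvd_triv_left even_add even_zero length_append)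
    then obtain c where "altitude c = 0" "open_bridge c = y"
      using open_bridge_surject split(3) by blast
    then show "w \<in> walk_of_bridges ` two_colored_dyck_bridges (2 * n)"
      using split len
      by (intro image_eqI[of _ _ "(b, c)"])
        (auto simp: two_colored_dyck_bridges_def walk_of_bridges_def dyck_bridge_iff)
  qed
qed

end
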